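(* For $r\in\mathbb N$, $\mathbf k=(k_1,\dots,k_r)\in\mathbb Z^r$ and $t\in(0,1)$, we have $${\rm Li}^{\rm des}(\mathbf k)(t)=\sum_{q\ge0}(-1)^q\frac{(\log t)^q}{q!}\sum_{\substack{\mathbf l=(l_j)\in\mathbb N_0^r\\ \mathbf m=(m_j)\in\mathbb Z^r\\ |\mathbf m|=-q}}a^r_{\mathbf l,\mathbf m}(q)\left(\prod_{j=1}^r(k_j)_{l_j}\right){\rm Li}_{\mathbf k+\mathbf m}(t).$$
   Context: **Notation.** $|\mathbf m|:=m_1+\cdots+m_r$; $(s)_0:=1$ and $(s)_k:=s(s+1)\cdots(s+k-1)$ (Pochhammer symbol). For $\mathbf k\in\mathbb Z^r$ and $|t|<1$, ${\rm Li}_{k_1,\dots,k_r}(t):=\sum_{0<n_1<\cdots<n_r}\frac{t^{n_r}}{n_1^{k_1}\cdots n_r^{k_r}}$ (multiple polylogarithm). **Coefficients.** For indeterminates $u_j,v_j$ ($1\le j\le r$) and the convention $v_0^{-1}:=0$, let $$\mathcal G_r:=\prod_{j=1}^r\{1-(u_jv_j+\cdots+u_rv_r)(v_j^{-1}-v_{j-1}^{-1})\}.$$ For $q\ge0$ the integers $a^r_{\mathbf l,\mathbf m}(q)$ are defined by $$\left(v_r^{-1}\frac{\partial}{\partial u_r}\right)^q[\mathcal G_r]=\sum_{\substack{\mathbf l\in\mathbb N_0^r,\ \mathbf m\in\mathbb Z^r\\ |\mathbf m|=-q}}a^r_{\mathbf l,\mathbf m}(q)\prod_{j=1}^ru_j^{l_j}v_j^{m_j}$$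 (for $q>r$ the left-hand side is $0$, so all $a^r_{\mathbf l,\mathbf m}(q)$ vanish and the sum over $q$ is finite). **The functions ${\rm Li}^{\rm des}$.** Let $\mathcal P_{(0,1)}:=\{f(t)\in t\mathbb R[[t]] : f(t)\text{ converges for } t\in(0,1)\}$ and let $\mathcal A:=\mathcal P_{(0,1)}[\log t]$ be the set of finite sums $\sum_{j=0}^N f_j(t)(\log t)^j$ with $f_j\in\mathcal P_{(0,1)}$. The operators $J[f]:=\int_0^t f(z)\frac{dz}{z}$ and $D[f]:=t\frac{df}{dt}$ map $\mathcal A$ to $\mathcal A$ and are mutually inverse; write $J^{-k}=D^k$ for $k\ge0$. Put ${\rm Li}^{\rm des}(0)(t):=\frac{t}{1-t}+\frac{t\log t}{(1-t)^2}\in\mathcal A$ and, for $\mathbf k\in\mathbb Z^r$, $${\rm Li}^{\rm des}(\mathbf k)(t):=J^{k_r}\Bigl[{\rm Li}^{\rm des}(0)(t)\,J^{k_{r-1}}\bigl[{\rm Li}^{\rm des}(0)(t)\cdots J^{k_1}[{\rm Li}^{\rm des}(0)(t)]\cdots\bigr]\Bigr].$$ *)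

theory Defs
  imports "HOL-Analysis.Analysis" "HOL-Library.Poly_Mapping"
begin

section \<open>The coefficients\<close>

text \<open>
  \<open>\<int>[u\<^sub>1, u\<^sub>2, \<dots>][v\<^sub>1\<^sup>\<plusminus>, v\<^sub>2\<^sup>\<plusminus>, \<dots>]\<close>: a monomial
  \<open>\<Prod>j. u\<^sub>j ^ l\<^sub>j * v\<^sub>j ^ m\<^sub>j\<close> is represented by the pair \<open>(l, m)\<close> of finitely supported
  exponent functions; multiplication is the convolution product of \<^theory>\<open>HOL-Library.Poly_Mapping\<close>.
\<close>

type_synonym uv_laurent = "((nat \<Rightarrow>\<^sub>0 nat) \<times> (nat \<Rightarrow>\<^sub>0 int)) \<Rightarrow>\<^sub>0 int"

definition U :: "nat \<Rightarrow> uv_laurent" where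
  "U j = Poly_Mapping.single (Poly_Mapping.single j 1, 0) 1"

definition V :: "nat \<Rightarrow> uv_laurent" where
  "V j = Poly_Mapping.single (0, Poly_Mapping.single j 1) 1"

text \<open>Index \<open>0\<close> encodes the convention \<open>v\<^sub>0\<^sup>-\<^sup>1 = 0\<close>.\<close>

definition V_inv :: "nat \<Rightarrow> uv_laurent" where
  "V_inv j = (if j = 0 then 0 else Poly_Mapping.single (0, Poly_Mapping.single j (- 1)) 1)"

lemma V_mult_V_inv: "j \<noteq> 0 \<Longrightarrow> V j * V_inv j = 1"
  by (simp add: V_def V_inv_def Poly_Mapping.mult_single flip: Poly_Mapping.single_add)
     (simp flip: zero_prod_def)

definition \<G> :: "nat \<Rightarrow> uv_laurent" where
  "\<G> r = (\<Prod>j=1..r. 1 - (\<Sum>i=j..r. U i * V i) * (V_inv j - V_inv (j - 1)))"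

text \<open>
  Partial derivative with respect to \<open>u\<^sub>j\<close>. The exponent subtraction truncates only for monomials
  with \<open>l\<^sub>j = 0\<close>, and these get coefficient \<open>0\<close>.
\<close>

definition deriv_u :: "nat \<Rightarrow> uv_laurent \<Rightarrow> uv_laurent" where
  "deriv_u j p = (\<Sum>(l, m)\<in>Poly_Mapping.keys p.
     Poly_Mapping.single (l - Poly_Mapping.single j 1, m)
       (int (Poly_Mapping.lookup l j) * Poly_Mapping.lookup p (l, m)))"

lemma lookup_deriv_u:
  "Poly_Mapping.lookup (deriv_u j p) (l, m) =
     (int (Poly_Mapping.lookup l j) + 1) * Poly_Mapping.lookup p (l + Poly_Mapping.single j 1, m)"
proof -
  let ?e = "Poly_Mapping.single j (1::nat)"
  let ?f = "\<lambda>x. int (Poly_Mapping.lookup (fst x) j) * Poly_Mapping.lookup p x"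
  have iff: "(fst x - ?e = l \<and> snd x = m) \<longleftrightarrow> x = (l + ?e, m)" if "?f x \<noteq> 0" for x
  proof -
    have "Poly_Mapping.lookup (fst x) j \<noteq> 0" using that by auto
    hence "fst x = (fst x - ?e) + ?e"
      by (intro poly_mapping_eqI) (auto simp: lookup_add lookup_minus lookup_single when_def)
    thus ?thesis by (cases x) auto
  qed
  have "Poly_Mapping.lookup (deriv_u j p) (l, m) =
        (\<Sum>x\<in>Poly_Mapping.keys p. if fst x - ?e = l \<and> snd x = m then ?f x else 0)"
    unfolding deriv_u_def
    by (auto simp: lookup_sum lookup_single when_def case_prod_unfold intro!: sum.cong)
  also have "\<dots> = (\<Sum>x\<in>Poly_Mapping.keys p. if x = (l + ?e, m) then ?f x else 0)"
    using iff by (intro sum.cong) auto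
  also have "\<dots> = ?f (l + ?e, m)"
    by (auto simp: sum.delta in_keys_iff)
  finally show ?thesis by (simp add: lookup_add)
qed

definition coeff_a :: "nat \<Rightarrow> nat \<Rightarrow> (nat \<Rightarrow>\<^sub>0 nat) \<Rightarrow> (nat \<Rightarrow>\<^sub>0 int) \<Rightarrow> int" where
  "coeff_a r q l m =
     Poly_Mapping.lookup (((\<lambda>p. V_inv r * deriv_u r p) ^^ q) (\<G> r)) (l, m)"

text \<open>The index set \<open>{(l, m) \<in> \<nat>\<^sub>0\<^sup>r \<times> \<int>\<^sup>r. |m| = - q}\<close>; it is infinite.\<close>

definition index_set :: "nat \<Rightarrow> nat \<Rightarrow> ((nat \<Rightarrow>\<^sub>0 nat) \<times> (nat \<Rightarrow>\<^sub>0 int)) set" where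
  "index_set r q = {(l, m). Poly_Mapping.keys l \<subseteq> {1..r} \<and> Poly_Mapping.keys m \<subseteq> {1..r} \<and>
     (\<Sum>j=1..r. Poly_Mapping.lookup m j) = - int q}"

text \<open>Hence an \<^const>\<open>infsum\<close> over \<^const>\<open>index_set\<close> weighted by \<^const>\<open>coeff_a\<close> is a finite sum.\<close>

lemma finite_coeff_a_support: "finite {(l, m). coeff_a r q l m \<noteq> 0}"
  by (rule finite_subset[OF _ finite_keys[of "((\<lambda>p. V_inv r * deriv_u r p) ^^ q) (\<G> r)"]])
     (auto simp: coeff_a_def in_keys_iff)

section \<open>Multiple polylogarithms in one variable\<close>

definition multi_polylog :: "nat \<Rightarrow> (nat \<Rightarrow> int) \<Rightarrow> real \<Rightarrow> real" where
  "multi_polylog r k t =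
     (\<Sum>\<^sub>\<infinity>n\<in>{n \<in> {1..r} \<rightarrow>\<^sub>E {1::nat..}. strict_mono_on {1..r} n}.
        t ^ n r / (\<Prod>j=1..r. real (n j) powi k j))"

section \<open>The desingularized functions\<close>

text \<open>
  Elements of \<open>\<A> = \<P>\<^sub>(\<^sub>0\<^sub>,\<^sub>1\<^sub>)[log t]\<close> are represented by total functions of which only the values on
  \<open>(0,1)\<close> matter: on this interval, \<open>op_J f\<close> and \<open>op_D f\<close> depend only on \<open>f\<close> restricted to it.
  For \<open>f \<in> \<A>\<close> the integrand \<open>f z / z\<close> has at most logarithmic growth at \<open>0\<close>, so the integral exists.
\<close>

definition op_J :: "(real \<Rightarrow> real) \<Rightarrow> real \<Rightarrow> real" where
  "op_J f t = integral {0..t} (\<lambda>z. f z / z)"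

definition op_D :: "(real \<Rightarrow> real) \<Rightarrow> real \<Rightarrow> real" where
  "op_D f t = t * deriv f t"

definition J_pow :: "int \<Rightarrow> (real \<Rightarrow> real) \<Rightarrow> real \<Rightarrow> real" where
  "J_pow k = (if k \<ge> 0 then op_J ^^ nat k else op_D ^^ nat (- k))"

definition Li_des0 :: "real \<Rightarrow> real" where
  "Li_des0 t = t / (1 - t) + t * ln t / (1 - t)\<^sup>2"

text \<open>The value \<open>1\<close> for the empty index only serves to start the recursion.\<close>

fun Li_des :: "nat \<Rightarrow> (nat \<Rightarrow> int) \<Rightarrow> real \<Rightarrow> real" where
  "Li_des 0 k = (\<lambda>t. 1)"
| "Li_des (Suc r) k = J_pow (k (Suc r)) (\<lambda>t. Li_des0 t * Li_des r k t)"

end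

theory Submission imports Defs "HOL-Real_Asymp.Real_Asymp" begin

text \<open>
  For fixed \<open>k\<close> and \<open>t\<close> let \<open>\<phi>\<^sub>k\<close> be the linear functional
  \<open>u\<^sup>l v\<^sup>m \<mapsto> (\<Prod>j. (k\<^sub>j)\<^sub>l\<^sub>j) Li\<^sub>k\<^sub>+\<^sub>m(t)\<close> on Laurent polynomials, and let \<open>T\<close> be the
  derivation \<open>v\<^sub>r\<^sup>-\<^sup>1 \<partial>/\<partial>u\<^sub>r\<close>. The right-hand side is
  \<open>F\<^sub>r(k) = \<Sum>q. (- log t)\<^sup>q/q! \<phi>\<^sub>k(T\<^sup>q \<G>\<^sub>r)\<close>. Since \<open>(s - 1)\<^sub>n = (s)\<^sub>n - n (s)\<^sub>n\<^sub>-\<^sub>1\<close>, lowering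
  \<open>k\<^sub>r\<close> by one replaces \<open>\<phi>\<^sub>k(p)\<close> by \<open>\<phi>\<^sub>k(v\<^sub>r\<^sup>-\<^sup>1 p - T p)\<close>, which is exactly the effect of \<open>t d/dt\<close>
  on \<open>F\<^sub>r\<close>; as \<open>F\<^sub>r\<close> vanishes at \<open>0\<close>, the operator \<open>J\<close> raises \<open>k\<^sub>r\<close> by one. It remains to see that
  \<open>F\<^sub>r\<^sub>+\<^sub>1\<close> at \<open>k\<^sub>r\<^sub>+\<^sub>1 = 0\<close> equals \<open>Li\<^sup>d\<^sup>e\<^sup>s(0) F\<^sub>r\<close>. There \<open>\<phi>\<^sub>k\<close> kills the multiples of \<open>u\<^sub>r\<^sub>+\<^sub>1\<close>, and
  modulo these the last factor of \<open>\<G>\<^sub>r\<^sub>+\<^sub>1\<close> contributes \<open>1 + log t (v\<^sub>r\<^sub>+\<^sub>1\<^sup>-\<^sup>1 - v\<^sub>r\<^sup>-\<^sup>1)\<close>, while the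
  others behave like \<open>\<G>\<^sub>r\<close> because they contain \<open>u\<^sub>r v\<^sub>r\<close> and \<open>u\<^sub>r\<^sub>+\<^sub>1 v\<^sub>r\<^sub>+\<^sub>1\<close> only through their sum.
  Summing geometric series over the last summation index gives the factor
  \<open>t/(1 - t) + t log t/(1 - t)\<^sup>2\<close>.
\<close>

section \<open>Linear functionals\<close>

text \<open>The weight stays arbitrary so that multiplying \<open>p\<close> by a monomial, or
  differentiating it, can be absorbed into a change of \<open>w\<close>.\<close>

definition lin :: "('a \<Rightarrow> real) \<Rightarrow> ('a \<Rightarrow>\<^sub>0 int) \<Rightarrow> real" where
  "lin w p = (\<Sum>x\<in>Poly_Mapping.keys p. real_of_int (Poly_Mapping.lookup p x) * w x)"

lemma lin_superset:
  assumes "finite A" "Poly_Mapping.keys p \<subseteq> A"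
  shows "lin w p = (\<Sum>x\<in>A. real_of_int (Poly_Mapping.lookup p x) * w x)"
  unfolding lin_def by (rule sum.mono_neutral_left) (use assms in \<open>auto simp: in_keys_iff\<close>)

lemma lin_0 [simp]: "lin w 0 = 0"
  by (simp add: lin_def)

lemma lin_single [simp]: "lin w (Poly_Mapping.single x c) = real_of_int c * w x"
  by (simp add: lin_def)

lemma lin_diff: "lin w (p - q) = lin w p - lin w q"
proof -
  let ?A = "Poly_Mapping.keys p \<union> Poly_Mapping.keys q"
  have "Poly_Mapping.keys (p - q) \<subseteq> ?A" by (rule keys_diff)
  thus ?thesis
    by (simp add: lin_superset[of ?A] lookup_minus left_diff_distrib sum_subtractf)
qed

lemma lin_add: "lin w (p + q) = lin w p + lin w q"
  using lin_diff[of w "p + q" q] by simp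

lemma lin_sum: "lin w (sum f A) = (\<Sum>i\<in>A. lin w (f i))"
  by (induction A rule: infinite_finite_induct) (auto simp: lin_add)

lemma lin_cong:
  "(\<And>x. x \<in> Poly_Mapping.keys p \<Longrightarrow> w x = w' x) \<Longrightarrow> lin w p = lin w' p"
  unfolding lin_def by (intro sum.cong) auto

lemma lin_mult_single:
  fixes p :: "('a :: comm_monoid_add) \<Rightarrow>\<^sub>0 int"
  shows "lin w (Poly_Mapping.single a c * p) = real_of_int c * lin (\<lambda>x. w (a + x)) p"
  by (induction p rule: frag_induction[OF subset_refl])
     (simp_all add: lin_diff right_diff_distrib mult_single)

lemma lin_of_nat_mult:
  fixes p :: "('a :: comm_monoid_add) \<Rightarrow>\<^sub>0 int"
  shows "lin w (of_nat q * p) = real q * lin w p"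
  using lin_mult_single[of w 0 "int q" p] by (simp flip: of_nat_single)

section \<open>The derivation \<open>v\<^sub>j\<^sup>-\<^sup>1 \<partial>/\<partial>u\<^sub>j\<close>\<close>

lemma deriv_u_0 [simp]: "deriv_u j 0 = 0"
  by (simp add: deriv_u_def)

lemma deriv_u_add: "deriv_u j (p + q) = deriv_u j p + deriv_u j q"
  by (intro poly_mapping_eqI) (auto simp: lookup_deriv_u lookup_add algebra_simps)

lemma deriv_u_diff: "deriv_u j (p - q) = deriv_u j p - deriv_u j q"
  by (intro poly_mapping_eqI) (auto simp: lookup_deriv_u lookup_minus algebra_simps)

lemma deriv_u_single:
  "deriv_u j (Poly_Mapping.single (l, m) c) =
     Poly_Mapping.single (l - Poly_Mapping.single j 1, m) (int (Poly_Mapping.lookup l j) * c)"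
  by (cases "c = 0") (auto simp: deriv_u_def)

lemma deriv_u_mult_single:
  "deriv_u j (Poly_Mapping.single (l, m) 1 * Poly_Mapping.single (l', m') 1) =
   deriv_u j (Poly_Mapping.single (l, m) 1) * Poly_Mapping.single (l', m') 1 +
   Poly_Mapping.single (l, m) 1 * deriv_u j (Poly_Mapping.single (l', m') 1)"
proof -
  let ?e = "Poly_Mapping.single j (1::nat)" and ?n = "\<lambda>l. int (Poly_Mapping.lookup l j)"
  \<comment> \<open>If the exponent of u_j in \<open>l\<close> is 0, truncated subtraction can break
    the equality of exponents, but then the coefficient \<open>?n l\<close> is 0.\<close>
  have 1: "Poly_Mapping.single ((l - ?e) + l', m + m') (?n l) = Poly_Mapping.single (l + l' - ?e, m + m') (?n l)"
  proof (cases "Poly_Mapping.lookup l j = 0")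
    case False
    hence "(l - ?e) + l' = l + l' - ?e"
      by (intro poly_mapping_eqI) (auto simp: lookup_add lookup_minus lookup_single when_def)
    thus ?thesis by (simp only:)
  qed simp
  have 2: "Poly_Mapping.single (l + (l' - ?e), m + m') (?n l') = Poly_Mapping.single (l + l' - ?e, m + m') (?n l')"
  proof (cases "Poly_Mapping.lookup l' j = 0")
    case False
    hence "l + (l' - ?e) = l + l' - ?e"
      by (intro poly_mapping_eqI) (auto simp: lookup_add lookup_minus lookup_single when_def)
    thus ?thesis by (simp only:)
  qed simp
  have "deriv_u j (Poly_Mapping.single (l, m) 1 * Poly_Mapping.single (l', m') 1) =
        Poly_Mapping.single (l + l' - ?e, m + m') (?n l + ?n l')"
    by (simp only: mult_single deriv_u_single add_Pair lookup_add mult_1_right of_nat_add)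
  also have "\<dots> = Poly_Mapping.single ((l - ?e) + l', m + m') (?n l) +
        Poly_Mapping.single (l + (l' - ?e), m + m') (?n l')"
    by (simp only: 1 2 single_add)
  also have "\<dots> = deriv_u j (Poly_Mapping.single (l, m) 1) * Poly_Mapping.single (l', m') 1 +
   Poly_Mapping.single (l, m) 1 * deriv_u j (Poly_Mapping.single (l', m') 1)"
    by (simp only: mult_single deriv_u_single add_Pair mult_1_right mult_1_left)
  finally show ?thesis .
qed

text \<open>Both sides are bilinear, so the rule for monomials suffices;
  \<open>frag_induction\<close> extends it first in \<open>q\<close>, then in
  \<open>p\<close>.\<close>

lemma deriv_u_mult: "deriv_u j (p * q) = deriv_u j p * q + p * deriv_u j q"
proof -
  have *: "deriv_u j (Poly_Mapping.single x 1 * q) =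
    deriv_u j (Poly_Mapping.single x 1) * q + Poly_Mapping.single x 1 * deriv_u j q" for x
  proof (induction q rule: frag_induction[OF subset_refl])
    case (2 y)
    show ?case using deriv_u_mult_single by (cases x; cases y) blast
  next
    case (3 a b)
    thus ?case by (simp add: deriv_u_diff right_diff_distrib)
  qed simp
  show ?thesis
    by (induction p rule: frag_induction[OF subset_refl])
       (simp_all add: deriv_u_diff left_diff_distrib *)
qed

lemma deriv_u_commute: "deriv_u i (deriv_u j p) = deriv_u j (deriv_u i p)"
  by (intro poly_mapping_eqI)
     (auto simp: lookup_deriv_u lookup_add lookup_single when_def add_ac split: prod.splits)

text \<open>Moves the derivative onto the weight, the form in which the Pochhammer shift produces
  it.\<close>

lemma lin_deriv_u:
  "lin w (deriv_u j p) =
     lin (\<lambda>(l, m). real (Poly_Mapping.lookup l j) * w (l - Poly_Mapping.single j 1, m)) p"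
  unfolding deriv_u_def lin_sum
  by (auto simp: lin_def[of _ p] case_prod_unfold intro!: sum.cong)

lemma deriv_u_1 [simp]: "deriv_u j 1 = 0"
  using deriv_u_single[of j 0 0 1] by (simp flip: zero_prod_def)

lemma deriv_u_V_inv [simp]: "deriv_u j (V_inv i) = 0"
  by (auto simp: V_inv_def deriv_u_single)

lemma deriv_u_V [simp]: "deriv_u j (V i) = 0"
  by (auto simp: V_def deriv_u_single)

lemma deriv_u_U: "deriv_u j (U i) = (if i = j then 1 else 0)"
  by (auto simp: U_def deriv_u_single lookup_single simp flip: zero_prod_def)

text \<open>The operator iterated in \<open>coeff_a\<close>, for any index. At \<open>j = 0\<close>
  it is the zero map, so the passage from \<open>r = 0\<close> to \<open>r = 1\<close> follows the
  general pattern.\<close>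

definition vdu :: "nat \<Rightarrow> uv_laurent \<Rightarrow> uv_laurent" where
  "vdu j p = V_inv j * deriv_u j p"

lemma vdu_0 [simp]: "vdu j 0 = 0"
  and vdu_1 [simp]: "vdu j 1 = 0"
  and vdu_V_inv [simp]: "vdu j (V_inv i) = 0"
  by (simp_all add: vdu_def)

lemma vdu_add: "vdu j (p + q) = vdu j p + vdu j q"
  and vdu_diff: "vdu j (p - q) = vdu j p - vdu j q"
  and vdu_mult: "vdu j (p * q) = vdu j p * q + p * vdu j q"
  by (simp_all add: vdu_def deriv_u_add deriv_u_diff deriv_u_mult algebra_simps)

lemma vdu_sum: "vdu j (sum f A) = (\<Sum>i\<in>A. vdu j (f i))"
  by (induction A rule: infinite_finite_induct) (auto simp: vdu_add)

lemma vdu_commute: "vdu i (vdu j p) = vdu j (vdu i p)"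
  by (simp add: vdu_def deriv_u_mult deriv_u_commute[of i] mult_ac)

lemma vdu_U_V: "vdu j (U i * V i) = (if i = j \<and> j \<noteq> 0 then 1 else 0)"
  using V_mult_V_inv[of j]
  by (cases "j = 0") (auto simp: vdu_def deriv_u_mult deriv_u_U V_inv_def mult.commute)

section \<open>Comparing \<open>\<G> (Suc r)\<close> with \<open>\<G> r\<close>\<close>

lemma vdu_prod_eq:
  assumes "\<And>x. x \<in> A \<Longrightarrow> vdu i (f x) = vdu j (f x)"
  shows "vdu i (prod f A) = vdu j (prod f A)"
  using assms by (induction A rule: infinite_finite_induct) (auto simp: vdu_mult)

lemma vdu_of_nat [simp]: "vdu j (of_nat n) = 0"
  by (induction n) (auto simp: vdu_add)

text \<open>The second derivative of \<open>y\<close> vanishes, so the Leibniz rule leaves only the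
  terms with at most one derivative on \<open>y\<close>.\<close>

lemma funpow_vdu_mult_linear:
  assumes "vdu j y = - w" "vdu j w = 0"
  shows "(vdu j ^^ Suc q) (h * y) =
           (vdu j ^^ Suc q) h * y - of_nat (Suc q) * (w * (vdu j ^^ q) h)"
proof (induction q)
  case 0
  show ?case using assms by (simp add: vdu_mult mult.commute)
next
  case (Suc q)
  have "(vdu j ^^ Suc (Suc q)) (h * y) =
      vdu j ((vdu j ^^ Suc q) h * y - of_nat (Suc q) * (w * (vdu j ^^ q) h))"
    using Suc by simp
  also have "\<dots> = (vdu j ^^ Suc (Suc q)) h * y - of_nat (Suc (Suc q)) * (w * (vdu j ^^ Suc q) h)"
    by (simp only: vdu_diff vdu_mult assms vdu_of_nat funpow.simps o_apply)
       (simp add: algebra_simps)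
  finally show ?case .
qed

text \<open>The factors of \<open>\<G> (Suc r)\<close> other than the last; setting \<open>u\<^sub>r\<^sub>+\<^sub>1 = 0\<close> turns their product into \<open>\<G> r\<close>.\<close>

definition \<H> :: "nat \<Rightarrow> uv_laurent" where
  "\<H> r = (\<Prod>j=1..r. 1 - (\<Sum>i=j..Suc r. U i * V i) * (V_inv j - V_inv (j - 1)))"

lemma \<G>_Suc:
  "\<G> (Suc r) = \<H> r * (1 - U (Suc r) * V (Suc r) * (V_inv (Suc r) - V_inv r))"
  by (simp add: \<G>_def \<H>_def)

text \<open>Each factor contains u_r v_r and u_(r+1) v_(r+1) only through their sum, which both
  derivations map to 1.\<close>

lemma vdu_\<H>: "vdu (Suc r) (\<H> r) = vdu r (\<H> r)"
  unfolding \<H>_def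
proof (rule vdu_prod_eq)
  fix j assume j: "j \<in> {1..r}"
  have "(\<Sum>i=j..Suc r. vdu k (U i * V i)) = 1" if "k \<in> {j..Suc r}" for k
    using that j by (simp add: vdu_U_V)
  hence "vdu k (\<Sum>i=j..Suc r. U i * V i) = 1" if "k \<in> {j..Suc r}" for k
    using that by (simp only: vdu_sum)
  thus "vdu (Suc r) (1 - (\<Sum>i=j..Suc r. U i * V i) * (V_inv j - V_inv (j - 1))) =
        vdu r (1 - (\<Sum>i=j..Suc r. U i * V i) * (V_inv j - V_inv (j - 1)))"
    using j by (simp only: vdu_diff vdu_mult vdu_1 vdu_V_inv) simp
qed

text \<open>The two derivations commute, so their agreement on \<open>\<H> r\<close> passes to all
  iterates.\<close>

lemma funpow_vdu_\<H>: "(vdu (Suc r) ^^ q) (\<H> r) = (vdu r ^^ q) (\<H> r)"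
proof (induction q)
  case (Suc q)
  have "vdu (Suc r) ((vdu r ^^ q) p) = (vdu r ^^ q) (vdu (Suc r) p)" for p
    by (induction q) (auto simp: vdu_commute[of "Suc r"])
  thus ?case using Suc by (simp add: vdu_\<H> funpow_swap1)
qed simp

lemma dvd_prod_diff:
  fixes f g :: "'a \<Rightarrow> 'b :: comm_ring_1"
  assumes "\<And>x. x \<in> A \<Longrightarrow> d dvd f x - g x"
  shows "d dvd prod f A - prod g A"
  using assms
proof (induction A rule: infinite_finite_induct)
  case (insert x F)
  have "prod f (insert x F) - prod g (insert x F) =
        (f x - g x) * prod f F + g x * (prod f F - prod g F)"
    using insert by (simp add: algebra_simps)
  thus ?case using insert by (auto intro!: dvd_add)
qed auto

lemma U_dvd_\<H>_diff: "U (Suc r) dvd \<H> r - \<G> r"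
  unfolding \<H>_def \<G>_def
proof (rule dvd_prod_diff)
  fix j assume "j \<in> {1..r}"
  hence "1 - (\<Sum>i=j..Suc r. U i * V i) * (V_inv j - V_inv (j - 1)) -
        (1 - (\<Sum>i=j..r. U i * V i) * (V_inv j - V_inv (j - 1))) =
        U (Suc r) * (- V (Suc r) * (V_inv j - V_inv (j - 1)))"
    by (simp add: algebra_simps)
  thus "U (Suc r) dvd 1 - (\<Sum>i=j..Suc r. U i * V i) * (V_inv j - V_inv (j - 1)) -
        (1 - (\<Sum>i=j..r. U i * V i) * (V_inv j - V_inv (j - 1)))" by (metis dvd_triv_left)
qed

text \<open>The derivation treats \<open>U i\<close> as a constant, so it preserves the ideal
  generated by it.\<close>

lemma U_dvd_vdu:
  assumes "U i dvd p" "i \<noteq> j"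
  shows "U i dvd vdu j p"
proof -
  obtain q where "p = U i * q" using assms by auto
  hence "vdu j p = U i * vdu j q"
    using assms by (simp add: vdu_mult) (simp add: vdu_def deriv_u_U)
  thus ?thesis by simp
qed

lemma funpow_vdu_diff: "(vdu j ^^ q) (a - b) = (vdu j ^^ q) a - (vdu j ^^ q) b"
  by (induction q) (auto simp: vdu_diff)

text \<open>\<open>funpow_vdu_\<H>\<close> trades \<open>vdu (Suc r)\<close>, which does not
  preserve the multiples of \<open>U (Suc r)\<close>, for \<open>vdu r\<close>, which does.\<close>

lemma U_dvd_funpow_vdu_diff: "U (Suc r) dvd (vdu (Suc r) ^^ q) (\<H> r) - (vdu r ^^ q) (\<G> r)"
proof -
  have "U (Suc r) dvd (vdu r ^^ q) (\<H> r - \<G> r)"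
    by (induction q) (auto simp: U_dvd_\<H>_diff intro!: U_dvd_vdu)
  thus ?thesis by (simp add: funpow_vdu_diff funpow_vdu_\<H>)
qed

section \<open>Supports\<close>

text \<open>The bound \<open>e\<close> on the degree in \<open>u\<^sub>r\<close> is an integer, so that the set is empty for \<open>e < 0\<close>.\<close>

definition exponents :: "nat \<Rightarrow> int \<Rightarrow> int \<Rightarrow> ((nat \<Rightarrow>\<^sub>0 nat) \<times> (nat \<Rightarrow>\<^sub>0 int)) set" where
  "exponents r d e = {(l, m). Poly_Mapping.keys l \<subseteq> {1..r} \<and> Poly_Mapping.keys m \<subseteq> {1..r} \<and>
     (\<Sum>j=1..r. Poly_Mapping.lookup m j) = d \<and> int (Poly_Mapping.lookup l r) \<le> e}"

lemma exponents_add: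
  assumes "a \<in> exponents r d e" "b \<in> exponents r d' e'"
  shows "a + b \<in> exponents r (d + d') (e + e')"
  using assms keys_add[of "fst a" "fst b"] keys_add[of "snd a" "snd b"]
  by (cases a; cases b) (auto simp: exponents_def lookup_add sum.distrib)

lemma keys_mult_exponents:
  "Poly_Mapping.keys p \<subseteq> exponents r d e \<Longrightarrow> Poly_Mapping.keys q \<subseteq> exponents r d' e' \<Longrightarrow>
     Poly_Mapping.keys (p * q) \<subseteq> exponents r (d + d') (e + e')" for p q :: uv_laurent
  using keys_mult[of p q] by (blast intro: exponents_add)

lemma exponents_mono: "e \<le> e' \<Longrightarrow> exponents r d e \<subseteq> exponents r d e'"
  by (auto simp: exponents_def)

lemma keys_1_exponents: "Poly_Mapping.keys (1 :: uv_laurent) \<subseteq> exponents r 0 0"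
  by (auto simp: exponents_def zero_prod_def)

lemma keys_V_inv_exponents: "j \<le> r \<Longrightarrow> Poly_Mapping.keys (V_inv j) \<subseteq> exponents r (- 1) 0"
  by (auto simp: exponents_def V_inv_def lookup_single when_def)

lemma keys_U_V_exponents: "i \<in> {1..r} \<Longrightarrow> Poly_Mapping.keys (U i * V i) \<subseteq> exponents r 1 1"
  by (auto simp: exponents_def U_def V_def mult_single lookup_single when_def)

lemma keys_sum_subset:
  "(\<And>i. i \<in> A \<Longrightarrow> Poly_Mapping.keys (f i) \<subseteq> S) \<Longrightarrow>
     Poly_Mapping.keys (sum f A) \<subseteq> S"
  for f :: "_ \<Rightarrow> uv_laurent"
  using keys_sum[of f A] by blast

lemma keys_diff_subset:
  "Poly_Mapping.keys p \<subseteq> S \<Longrightarrow> Poly_Mapping.keys q \<subseteq> S \<Longrightarrow>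
     Poly_Mapping.keys (p - q) \<subseteq> S"
  for p q :: uv_laurent
  using keys_diff[of p q] by blast

text \<open>Each of the \<open>r\<close> factors has total degree 0 in the v_j and degree at most 1
  in u_r.\<close>

lemma keys_\<G>: "Poly_Mapping.keys (\<G> r) \<subseteq> exponents r 0 (int r)"
proof -
  define f where "f = (\<lambda>j. 1 - (\<Sum>i=j..r. U i * V i) * (V_inv j - V_inv (j - 1)))"
  have f: "Poly_Mapping.keys (f j) \<subseteq> exponents r 0 1" if "j \<in> {1..r}" for j
  proof -
    have "Poly_Mapping.keys (\<Sum>i=j..r. U i * V i) \<subseteq> exponents r 1 1"
      using that by (intro keys_sum_subset keys_U_V_exponents) auto
    moreover have "Poly_Mapping.keys (V_inv j - V_inv (j - 1)) \<subseteq> exponents r (- 1) 0"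
      using that by (intro keys_diff_subset keys_V_inv_exponents) auto
    ultimately have "Poly_Mapping.keys ((\<Sum>i=j..r. U i * V i) * (V_inv j - V_inv (j - 1))) \<subseteq> exponents r (1 + - 1) (1 + 0)"
      by (rule keys_mult_exponents)
    thus ?thesis
      using keys_1_exponents[of r] exponents_mono[of 0 1 r 0] unfolding f_def by (intro keys_diff_subset) auto
  qed
  have "n \<le> r \<Longrightarrow> Poly_Mapping.keys (prod f {1..n}) \<subseteq> exponents r 0 (int n)" for n
  proof (induction n)
    case 0
    show ?case using keys_1_exponents by simp
  next
    case (Suc n)
    thus ?case using keys_mult_exponents[OF Suc.IH f[of "Suc n"]] by (simp add: algebra_simps)
  qed
  thus ?thesis unfolding \<G>_def f_def by blast
qed

lemma keys_vdu:
  assumes "Poly_Mapping.keys p \<subseteq> exponents r d e"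
  shows "Poly_Mapping.keys (vdu r p) \<subseteq> exponents r (d - 1) (e - 1)"
proof -
  have "Poly_Mapping.keys (deriv_u r p) \<subseteq> exponents r d (e - 1)"
  proof safe
    fix l m assume "(l, m) \<in> Poly_Mapping.keys (deriv_u r p)"
    hence "(l + Poly_Mapping.single r 1, m) \<in> Poly_Mapping.keys p"
      by (auto simp: in_keys_iff lookup_deriv_u)
    hence "(l + Poly_Mapping.single r 1, m) \<in> exponents r d e" using assms by blast
    moreover have "Poly_Mapping.keys l \<subseteq> Poly_Mapping.keys (l + Poly_Mapping.single r 1)"
      by (auto simp: in_keys_iff lookup_add)
    ultimately show "(l, m) \<in> exponents r d (e - 1)" by (auto simp: exponents_def lookup_add)
  qed
  from keys_mult_exponents[OF keys_V_inv_exponents[OF order.refl] this] show ?thesis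
    by (simp add: vdu_def)
qed

lemma keys_funpow_vdu_\<G>: "Poly_Mapping.keys ((vdu r ^^ q) (\<G> r)) \<subseteq> exponents r (- int q) (int r - int q)"
proof (induction q)
  case (Suc q)
  have "- int q - 1 = - int (Suc q)" "int r - int q - 1 = int r - int (Suc q)" by simp_all
  thus ?case using keys_vdu[OF Suc] by (simp only: funpow.simps o_apply)
qed (simp add: keys_\<G>)

text \<open>Every application of \<open>vdu r\<close> lowers the bound on the degree in u_r by one;
  once the bound is negative, no exponent is left.\<close>

lemma funpow_vdu_\<G>_eq_0:
  assumes "r < q"
  shows "(vdu r ^^ q) (\<G> r) = 0"
proof -
  have "exponents r (- int q) (int r - int q) = {}" using assms by (auto simp: exponents_def)
  thus ?thesis using keys_funpow_vdu_\<G>[where r = r and q = q] by (simp only: subset_empty keys_eq_empty)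
qed

section \<open>Multiple polylogarithms as power series\<close>

text \<open>
  Starting with \<open>Li\<^sub>\<emptyset> = 1\<close>, that is with the coefficients of the constant series, makes the recursion
  uniform; \<^const>\<open>multi_polylog\<close> itself has the junk value \<open>t ^ undefined\<close> at \<open>r = 0\<close>.
\<close>

fun mpl_coeff :: "nat \<Rightarrow> (nat \<Rightarrow> int) \<Rightarrow> nat \<Rightarrow> real" where
  "mpl_coeff 0 k N = (if N = 0 then 1 else 0)"
| "mpl_coeff (Suc r) k N = (\<Sum>M<N. mpl_coeff r k M) * real N powi (- k (Suc r))"

definition mpl :: "nat \<Rightarrow> (nat \<Rightarrow> int) \<Rightarrow> real \<Rightarrow> real" where
  "mpl r k t = (suminf (\<lambda>N. mpl_coeff r k N * t ^ N))"

lemma mpl_coeff_cong: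
  "(\<And>j. j \<in> {1..r} \<Longrightarrow> k j = k' j) \<Longrightarrow> mpl_coeff r k N = mpl_coeff r k' N"
  by (induction r arbitrary: N) auto

lemma mpl_cong: "(\<And>j. j \<in> {1..r} \<Longrightarrow> k j = k' j) \<Longrightarrow> mpl r k = mpl r k'"
  using mpl_coeff_cong[of r k k'] by (simp add: mpl_def fun_eq_iff)

lemma mpl_coeff_nonneg: "mpl_coeff r k N \<ge> 0"
  by (induction r arbitrary: N) (auto intro!: sum_nonneg mult_nonneg_nonneg)

lemma mpl_coeff_at_0: "r \<ge> 1 \<Longrightarrow> mpl_coeff r k 0 = 0"
  by (cases r) auto

text \<open>This is t d/dt on the level of coefficients. At \<open>N = 0\<close> both sides vanish
  because the sum over \<open>M\<close> is empty.\<close>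

lemma of_nat_mult_mpl_coeff:
  assumes "r \<ge> 1"
  shows "real N * mpl_coeff r k N = mpl_coeff r (k(r := k r - 1)) N"
proof -
  obtain s where s: "r = Suc s" using assms by (cases r) auto
  have "mpl_coeff s (k(Suc s := x)) M = mpl_coeff s k M" for M x
    by (rule mpl_coeff_cong) auto
  moreover have "real N * real N powi (- k r) = real N powi (- (k r - 1))" if "N > 0"
    using that by (simp add: power_int_diff power_int_minus field_simps)
  ultimately show ?thesis
    by (cases "N = 0") (auto simp: s mult_ac)
qed

text \<open>Polynomial growth gives convergence for |t| < 1. Each level costs one power of
  \<open>N\<close> for the sum and at most |k_j| for the weight, whose exponent may have either
  sign.\<close>

lemma mpl_coeff_le: "\<exists>p. \<forall>N. mpl_coeff r k N \<le> real N ^ p"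
proof (induction r)
  case 0
  show ?case by (intro exI[of _ 0]) auto
next
  case (Suc r)
  then obtain p where p: "\<And>N. mpl_coeff r k N \<le> real N ^ p" by auto
  let ?m = "nat \<bar>k (Suc r)\<bar>"
  have "mpl_coeff (Suc r) k N \<le> real N ^ (Suc p + ?m)" for N
  proof (cases "N = 0")
    case False
    have "(\<Sum>M<N. mpl_coeff r k M) \<le> (\<Sum>M<N. real N ^ p)"
      by (intro sum_mono order.trans[OF p] power_mono) auto
    hence 1: "(\<Sum>M<N. mpl_coeff r k M) \<le> real N ^ Suc p" by simp
    have "real N powi (- k (Suc r)) \<le> real N powi (int ?m)"
      using False by (intro power_int_increasing) auto
    hence 2: "real N powi (- k (Suc r)) \<le> real N ^ ?m" unfolding power_int_of_nat .
    show ?thesis unfolding mpl_coeff.simps power_add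
      by (intro mult_mono 1 2) auto
  qed auto
  thus ?case by blast
qed

text \<open>Multiplying the termwise derivative of the series for \<open>p\<close> by
  \<open>x\<close> gives the series for \<open>Suc p\<close>.\<close>

lemma summable_of_nat_power_mult:
  fixes x :: real
  assumes "\<bar>x\<bar> < 1"
  shows "summable (\<lambda>n. real n ^ p * x ^ n)"
  using assms
proof (induction p arbitrary: x)
  case 0
  thus ?case by (simp add: summable_geometric)
next
  case (Suc p)
  have "summable (\<lambda>n. diffs (\<lambda>n. real n ^ p) n * x ^ n)"
    by (rule termdiff_converges[where K = 1]) (use Suc in auto)
  from sums_summable[OF diffs_equiv[OF this]]
  have "summable (\<lambda>n. x * (real n * real n ^ p * x ^ (n - Suc 0)))" by (rule summable_mult)
  moreover have "x * (real n * real n ^ p * x ^ (n - Suc 0)) = real n ^ Suc p * x ^ n" for n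
    by (cases n) auto
  ultimately show ?case by simp
qed

lemma summable_mpl:
  assumes "\<bar>t\<bar> < 1"
  shows "summable (\<lambda>N. mpl_coeff r k N * t ^ N)"
proof -
  obtain p where p: "\<And>N. mpl_coeff r k N \<le> real N ^ p" using mpl_coeff_le by metis
  show ?thesis
  proof (rule summable_comparison_test')
    show "summable (\<lambda>n. real n ^ p * \<bar>t\<bar> ^ n)" using assms by (intro summable_of_nat_power_mult) auto
    show "norm (mpl_coeff r k N * t ^ N) \<le> real N ^ p * \<bar>t\<bar> ^ N" for N
      using p[of N] mpl_coeff_nonneg[of r k N]
      by (auto simp: abs_mult power_abs intro!: mult_right_mono)
  qed
qed

lemma mpl_sums: "\<bar>t\<bar> < 1 \<Longrightarrow> (\<lambda>N. mpl_coeff r k N * t ^ N) sums mpl r k t"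
  unfolding mpl_def by (rule summable_sums[OF summable_mpl])

lemma mpl_at_0: "r \<ge> 1 \<Longrightarrow> mpl r k 0 = 0"
  unfolding mpl_def powser_zero by (simp add: mpl_coeff_at_0)

lemma mpl_0_left: "mpl 0 k t = 1"
proof -
  have "(\<lambda>N. mpl_coeff 0 k N * t ^ N) sums (\<Sum>N\<in>{0}. mpl_coeff 0 k N * t ^ N)"
    by (rule sums_finite) auto
  thus ?thesis by (simp add: mpl_def sums_iff)
qed

section \<open>Derivative of the power series and its behaviour at 0\<close>

lemma DERIV_mpl:
  assumes "r \<ge> 1" "0 < t" "t < 1"
  shows "(mpl r k has_real_derivative mpl r (k(r := k r - 1)) t / t) (at t)"
proof -
  let ?c = "mpl_coeff r k"
  have d: "(mpl r k has_real_derivative (suminf (\<lambda>n. diffs ?c n * t ^ n))) (at t)"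
    unfolding mpl_def
    by (rule termdiffs_strong'[where K = 1]) (use assms in \<open>auto intro: summable_mpl\<close>)
  have "summable (\<lambda>n. diffs ?c n * t ^ n)"
    by (rule termdiff_converges[where K = 1]) (use assms in \<open>auto intro: summable_mpl\<close>)
  from sums_mult[OF diffs_equiv[OF this], of t]
  have "(\<lambda>n. t * (real n * ?c n * t ^ (n - Suc 0))) sums (t * (suminf (\<lambda>n. diffs ?c n * t ^ n)))" .
  moreover have "t * (real n * ?c n * t ^ (n - Suc 0)) = mpl_coeff r (k(r := k r - 1)) n * t ^ n" for n
    using of_nat_mult_mpl_coeff[OF assms(1), of n k] by (cases n) (auto simp: mult_ac)
  ultimately have "mpl r (k(r := k r - 1)) t = t * (suminf (\<lambda>n. diffs ?c n * t ^ n))"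
    unfolding mpl_def by (simp add: sums_iff)
  thus ?thesis using d assms by simp
qed

text \<open>The series has no constant term, so it is t times a function continuous at 0, and t
  outweighs every power of ln t.\<close>

lemma tendsto_ln_power_mult_mpl:
  assumes "r \<ge> 1"
  shows "((\<lambda>t. ln t ^ q * mpl r k t) \<longlongrightarrow> 0) (at_right 0)"
proof -
  let ?c = "mpl_coeff r k"
  have "isCont (\<lambda>t. suminf (\<lambda>n. ?c (Suc n) * t ^ n)) (0 :: real)"
  proof (rule isCont_powser)
    show "summable (\<lambda>n. ?c (Suc n) * (1 / 2) ^ n)"
      using summable_mult[OF summable_ignore_initial_segment[OF summable_mpl[of "1/2" r k], of 1], of 2]
      by (simp add: mult_ac)
  qed simp
  hence "((\<lambda>t. suminf (\<lambda>n. ?c (Suc n) * t ^ n)) \<longlongrightarrow> (suminf (\<lambda>n. ?c (Suc n) * 0 ^ n))) (at_right (0 :: real))"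
    unfolding isCont_def using tendsto_within_subset by blast
  moreover have "((\<lambda>t :: real. ln t ^ q * t) \<longlongrightarrow> 0) (at_right 0)"
    by real_asymp
  ultimately have "((\<lambda>t. (ln t ^ q * t) * (suminf (\<lambda>n. ?c (Suc n) * t ^ n))) \<longlongrightarrow>
      0 * (suminf (\<lambda>n. ?c (Suc n) * 0 ^ n))) (at_right 0)"
    by (intro tendsto_mult)
  moreover have "eventually (\<lambda>t. (ln t ^ q * t) * (suminf (\<lambda>n. ?c (Suc n) * t ^ n)) =
      ln t ^ q * mpl r k t) (at_right 0)"
    using eventually_at_right_real[OF zero_less_one]
  proof eventually_elim
    case (elim t)
    have "(\<lambda>n. ?c (Suc n) * t ^ Suc n) sums mpl r k t"
      using mpl_sums[of t r k] elim mpl_coeff_at_0[OF assms] by (subst sums_Suc_iff) auto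
    hence "(\<lambda>n. ?c (Suc n) * t ^ Suc n / t) sums (mpl r k t / t)" by (rule sums_divide)
    hence "(\<lambda>n. ?c (Suc n) * t ^ n) sums (mpl r k t / t)" using elim by simp
    thus ?case using elim by (simp add: sums_iff)
  qed
  ultimately show ?thesis by (simp only: tendsto_cong mult_zero_left)
qed

section \<open>Geometric summation over the last index\<close>

lemma mpl_Suc_0:
  assumes "\<bar>t\<bar> < 1" "k (Suc r) = 0"
  shows "mpl (Suc r) k t = t / (1 - t) * mpl r k t"
proof -
  let ?S = "mpl (Suc r) k t"
  \<comment> \<open>the coefficients satisfy \<open>s (N + 1) = s N + c N\<close>, hence \<open>S = t (S + C)\<close>\<close>
  have "(\<lambda>N. mpl_coeff (Suc r) k (Suc N) * t ^ Suc N) sums ?S"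
    using mpl_sums[OF assms(1), of "Suc r" k] by (subst sums_Suc_iff) auto
  moreover have "(\<lambda>N. t * (mpl_coeff (Suc r) k N * t ^ N + mpl_coeff r k N * t ^ N)) sums (t * (?S + mpl r k t))"
    by (intro sums_mult sums_add mpl_sums assms)
  moreover have "t * (mpl_coeff (Suc r) k N * t ^ N + mpl_coeff r k N * t ^ N) =
                 mpl_coeff (Suc r) k (Suc N) * t ^ Suc N" for N
    using assms by (simp add: algebra_simps)
  ultimately have "?S = t * (?S + mpl r k t)"
    using sums_unique2 by (metis (no_types, lifting) sums_cong)
  thus ?thesis using assms by (simp add: field_simps)
qed

text \<open>Subtracting the second term cancels the contribution of the derivative of \<open>mpl r k\<close>.\<close>

lemma mpl_Suc_neg_1:
  assumes "\<bar>t\<bar> < 1" "k (Suc r) = 0"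
  shows "mpl (Suc r) (k(Suc r := - 1)) t - (if r = 0 then 0 else mpl (Suc r) (k(r := k r - 1)) t) =
           t / (1 - t)\<^sup>2 * mpl r k t"
proof -
  let ?k = "k(Suc r := - 1)" and ?B = "mpl (Suc r) (k(Suc r := - 1)) t"
  let ?S = "mpl (Suc r) k t" and ?A = "mpl r k t"
  \<comment> \<open>At \<open>r = 0\<close> the series is constant and t d/dt annihilates it; this
    agrees with the convention \<open>V_inv 0 = 0\<close>.\<close>
  let ?A' = "if r = 0 then 0 else mpl r (k(r := k r - 1)) t"
  have B: "real N * mpl_coeff (Suc r) k N = mpl_coeff (Suc r) ?k N" for N
    using of_nat_mult_mpl_coeff[of "Suc r" N k] assms by simp
  have A': "(\<lambda>N. real N * mpl_coeff r k N * t ^ N) sums ?A'"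
  proof (cases "r = 0")
    case True
    hence "(\<lambda>N. real N * mpl_coeff r k N * t ^ N) = (\<lambda>_. 0)" by auto
    thus ?thesis using True by simp
  next
    case False
    thus ?thesis using of_nat_mult_mpl_coeff[of r _ k] mpl_sums[OF assms(1), of r "k(r := k r - 1)"] by simp
  qed
  \<comment> \<open>Let c, s, b be the coefficients of \<open>?A\<close>, \<open>?S\<close>,
    \<open>?B\<close>. Since b(N) = N s(N), b(N+1) = (N+1)(s(N) + c(N)) = b(N) + s(N) + N c(N) +
    c(N).\<close>
  have "(\<lambda>N. mpl_coeff (Suc r) ?k (Suc N) * t ^ Suc N) sums ?B"
    using mpl_sums[OF assms(1), of "Suc r" ?k] by (subst sums_Suc_iff) auto
  moreover have "(\<lambda>N. t * (mpl_coeff (Suc r) ?k N * t ^ N + mpl_coeff (Suc r) k N * t ^ N +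
        real N * mpl_coeff r k N * t ^ N + mpl_coeff r k N * t ^ N)) sums (t * (?B + ?S + ?A' + ?A))"
    by (intro sums_mult sums_add mpl_sums assms A')
  moreover have "t * (mpl_coeff (Suc r) ?k N * t ^ N + mpl_coeff (Suc r) k N * t ^ N +
        real N * mpl_coeff r k N * t ^ N + mpl_coeff r k N * t ^ N) =
                 mpl_coeff (Suc r) ?k (Suc N) * t ^ Suc N" for N
    unfolding B[symmetric] using assms by (simp add: algebra_simps)
  ultimately have B_eq: "?B = t * (?B + ?S + ?A' + ?A)"
    using sums_unique2 by (metis (no_types, lifting) sums_cong)
  have S: "?S = t / (1 - t) * ?A"
    by (rule mpl_Suc_0) (use assms in auto)
  have S': "(if r = 0 then 0 else mpl (Suc r) (k(r := k r - 1)) t) = t / (1 - t) * ?A'"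
    using mpl_Suc_0[of t "k(r := k r - 1)" r] assms by simp
  have "1 - t > 0" using assms by auto
  moreover have "(1 - t) * ?B = t * (?S + ?A' + ?A)" using B_eq by (simp add: algebra_simps)
  ultimately have "?B = t * (?S + ?A' + ?A) / (1 - t)" by (simp add: eq_divide_eq mult.commute)
  \<comment> \<open>The terms in \<open>A'\<close> cancel, and t + b = 1 simplifies the
    rest.\<close>
  moreover have "t * (t / b * A + A' + A) / b - t / b * A' = t / b\<^sup>2 * A"
    if "b = 1 - t" "b > 0" for b A A' :: real
  proof -
    have "t * (t / b * A + A' + A) / b - t / b * A' = t * A * (t + b) / b\<^sup>2"
      using that(2) by (simp add: field_simps power2_eq_square)
    thus ?thesis using that(1) by simp
  qed
  ultimately show ?thesis unfolding S' S using \<open>1 - t > 0\<close> by presburger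
qed

section \<open>The nested sum as a power series\<close>

lemma strict_mono_on_fun_upd_Suc:
  fixes n :: "nat \<Rightarrow> nat"
  assumes "strict_mono_on {1..r} n" "r = 0 \<or> n r < N"
  shows "strict_mono_on {1..Suc r} (n(Suc r := N))"
proof (rule strict_mono_onI)
  fix i j assume ij: "i \<in> {1..Suc r}" "j \<in> {1..Suc r}" "i < j"
  have "n i \<le> n r" if "i \<le> r"
    using assms(1) that ij by (cases "i = r") (auto simp: strict_mono_on_def less_imp_le)
  thus "(n(Suc r := N)) i < (n(Suc r := N)) j"
    using ij assms by (cases "j = Suc r") (auto simp: strict_mono_on_def)
qed

text \<open>Groups the summation indices by their largest entry. The value 0 at \<open>r = 0\<close>
  matches the base case of \<open>mpl_coeff\<close>.\<close>

definition mpl_fibre :: "nat \<Rightarrow> nat \<Rightarrow> (nat \<Rightarrow> nat) set" where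
  "mpl_fibre r N = {n \<in> {1..r} \<rightarrow>\<^sub>E {1..}. strict_mono_on {1..r} n \<and> (if r = 0 then 0 else n r) = N}"

lemma mpl_fibre_0: "mpl_fibre 0 N = (if N = 0 then {\<lambda>_. undefined} else {})"
  by (auto simp: mpl_fibre_def strict_mono_on_def)

text \<open>Deleting the last entry \<open>N\<close> leaves a chain with a smaller largest entry
  \<open>M\<close>, which is the recursion of \<open>mpl_coeff\<close>.\<close>

lemma mpl_fibre_Suc: "mpl_fibre (Suc r) N = (\<Union>M<N. (\<lambda>n. n(Suc r := N)) ` mpl_fibre r M)"
proof (intro equalityI subsetI)
  fix n assume n: "n \<in> mpl_fibre (Suc r) N"
  define n' where "n' = n(Suc r := undefined)"
  define M where "M = (if r = 0 then 0 else n r)"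
  have "n (Suc r) = N" "n (Suc r) \<ge> 1" using n by (auto simp: mpl_fibre_def PiE_def Pi_def)
  hence "n = n'(Suc r := N)" by (auto simp: n'_def)
  moreover have "n' \<in> mpl_fibre r M"
    using n by (auto simp: mpl_fibre_def n'_def M_def PiE_def Pi_def extensional_def strict_mono_on_def)
  moreover have "M < N"
    using n \<open>n (Suc r) \<ge> 1\<close> by (auto simp: mpl_fibre_def M_def strict_mono_on_def)
  ultimately show "n \<in> (\<Union>M<N. (\<lambda>n. n(Suc r := N)) ` mpl_fibre r M)" by blast
next
  fix n assume "n \<in> (\<Union>M<N. (\<lambda>n. n(Suc r := N)) ` mpl_fibre r M)"
  then obtain M n' where n': "M < N" "n' \<in> mpl_fibre r M" "n = n'(Suc r := N)" by auto
  moreover have "strict_mono_on {1..Suc r} (n'(Suc r := N))"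
    using n' by (intro strict_mono_on_fun_upd_Suc) (auto simp: mpl_fibre_def split: if_splits)
  ultimately show "n \<in> mpl_fibre (Suc r) N"
    by (auto simp: mpl_fibre_def PiE_def Pi_def extensional_def)
qed

lemma finite_mpl_fibre: "finite (mpl_fibre r N)"
  by (induction r arbitrary: N) (auto simp: mpl_fibre_0 mpl_fibre_Suc)

lemma sum_mpl_fibre: "(\<Sum>n\<in>mpl_fibre r N. 1 / (\<Prod>j=1..r. real (n j) powi k j)) = mpl_coeff r k N"
proof (induction r arbitrary: N)
  case 0
  show ?case by (simp add: mpl_fibre_0)
next
  case (Suc r)
  let ?g = "\<lambda>r n. 1 / (\<Prod>j=1..r. real (n j) powi k j)"
  have inj: "inj_on (\<lambda>n. n(Suc r := N)) (mpl_fibre r M)" for M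
  proof (rule inj_onI)
    fix x y assume xy: "x \<in> mpl_fibre r M" "y \<in> mpl_fibre r M" "x(Suc r := N) = y(Suc r := N)"
    have "x (Suc r) = y (Suc r)" using xy by (auto simp: mpl_fibre_def PiE_def extensional_def)
    thus "x = y" using xy(3) by (metis fun_upd_triv fun_upd_upd)
  qed
  \<comment> \<open>The update leaves entry \<open>r\<close> alone, so \<open>M\<close> can be read
    off; for \<open>r = 0\<close> only \<open>M = 0\<close> has a nonempty fibre.\<close>
  have disj: "(\<lambda>n. n(Suc r := N)) ` mpl_fibre r M \<inter> (\<lambda>n. n(Suc r := N)) ` mpl_fibre r M' = {}"
    if "M \<noteq> M'" for M M'
  proof -
    have "M = M'" if "x \<in> mpl_fibre r M" "y \<in> mpl_fibre r M'" "x(Suc r := N) = y(Suc r := N)" for x y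
    proof -
      have "x r = y r" using fun_cong[OF that(3), of r] by simp
      thus ?thesis using that by (auto simp: mpl_fibre_def)
    qed
    thus ?thesis using that by blast
  qed
  have "(\<Sum>n\<in>mpl_fibre (Suc r) N. ?g (Suc r) n) =
        (\<Sum>M<N. \<Sum>n\<in>(\<lambda>n. n(Suc r := N)) ` mpl_fibre r M. ?g (Suc r) n)"
    unfolding mpl_fibre_Suc by (rule sum.UNION_disjoint) (auto simp: finite_mpl_fibre disj)
  also have "\<dots> = (\<Sum>M<N. \<Sum>n\<in>mpl_fibre r M. ?g (Suc r) (n(Suc r := N)))"
    by (simp add: sum.reindex[OF inj] del: prod.cl_ivl_Suc)
  also have "\<dots> = (\<Sum>M<N. \<Sum>n\<in>mpl_fibre r M. ?g r n * real N powi (- k (Suc r)))"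
    by (intro sum.cong refl) (auto simp: power_int_minus field_simps)
  also have "\<dots> = mpl_coeff (Suc r) k N"
    unfolding sum_distrib_right[symmetric] Suc by simp
  finally show ?case .
qed

text \<open>For t >= 0 all terms are nonnegative, so the unordered sum may be grouped by the largest
  index \<open>n r\<close>.\<close>

lemma multi_polylog_eq_mpl:
  assumes "r \<ge> 1" "0 \<le> t" "t < 1"
  shows "multi_polylog r k t = mpl r k t"
proof -
  let ?f = "\<lambda>n. t ^ n r / (\<Prod>j=1..r. real (n j) powi k j)"
  let ?S = "{n \<in> {1..r} \<rightarrow>\<^sub>E {1::nat..}. strict_mono_on {1..r} n}"
  let ?T = "Sigma UNIV (mpl_fibre r)"
  have fibre: "((\<lambda>n. ?f (snd (N, n))) has_sum (mpl_coeff r k N * t ^ N)) (mpl_fibre r N)" for N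
  proof (rule has_sum_finiteI[OF finite_mpl_fibre])
    have "sum ?f (mpl_fibre r N) = (\<Sum>n\<in>mpl_fibre r N. 1 / (\<Prod>j=1..r. real (n j) powi k j) * t ^ N)"
      using assms(1) by (intro sum.cong) (auto simp: mpl_fibre_def)
    thus "mpl_coeff r k N * t ^ N = (\<Sum>n\<in>mpl_fibre r N. ?f (snd (N, n)))"
      unfolding sum_mpl_fibre[symmetric] sum_distrib_right by simp
  qed
  have total: "((\<lambda>N. mpl_coeff r k N * t ^ N) has_sum mpl r k t) UNIV"
    using assms by (intro sums_nonneg_imp_has_sum mpl_sums mult_nonneg_nonneg mpl_coeff_nonneg) auto
  have "(\<lambda>x. ?f (snd x)) summable_on ?T"
    by (rule summable_on_SigmaI[OF fibre has_sum_imp_summable[OF total]])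
       (use assms in \<open>auto intro!: divide_nonneg_nonneg prod_nonneg\<close>)
  from has_sum_SigmaI[OF fibre total this]
  have "((\<lambda>x. ?f (snd x)) has_sum mpl r k t) ?T" .
  moreover have "bij_betw snd ?T ?S"
  proof (rule bij_betwI[where g = "\<lambda>n. (n r, n)"])
    show "snd \<in> ?T \<rightarrow> ?S" by (auto simp only: mpl_fibre_def mem_Sigma_iff snd_conv Pi_I)
    show "(\<lambda>n. (n r, n)) \<in> ?S \<rightarrow> ?T" using assms by (intro Pi_I) (simp add: mpl_fibre_def)
    show "(snd x r, snd x) = x" if "x \<in> ?T" for x
      using that assms by (cases x) (simp add: mpl_fibre_def)
  qed simp
  ultimately have "(?f has_sum mpl r k t) ?S"
    using has_sum_reindex_bij_betw[of snd ?T ?S ?f "mpl r k t"] by (simp only:)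
  thus ?thesis unfolding multi_polylog_def by (rule infsumI)
qed

section \<open>Evaluation of Laurent polynomials\<close>

text \<open>\<open>lin (wt r k t)\<close> is the evaluation functional \<phi> of index
  \<open>k\<close>.\<close>

definition wt :: "nat \<Rightarrow> (nat \<Rightarrow> int) \<Rightarrow> real \<Rightarrow> (nat \<Rightarrow>\<^sub>0 nat) \<times> (nat \<Rightarrow>\<^sub>0 int) \<Rightarrow> real" where
  "wt r k t = (\<lambda>(l, m). (\<Prod>j=1..r. pochhammer (real_of_int (k j)) (Poly_Mapping.lookup l j)) *
     mpl r (\<lambda>j. k j + Poly_Mapping.lookup m j) t)"

lemma wt_cong: "(\<And>j. j \<in> {1..r} \<Longrightarrow> k j = k' j) \<Longrightarrow> wt r k t = wt r k' t"
  unfolding wt_def case_prod_unfold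
  by (intro ext prod.cong arg_cong2[of _ _ _ _ "(*)"] fun_cong[OF mpl_cong]) auto

lemma lin_minus_weights: "lin (\<lambda>x. w x - w' x) p = lin w p - lin w' p"
  by (simp add: lin_def right_diff_distrib sum_subtractf)

lemma lin_mult_weights: "lin (\<lambda>x. c * w x) p = c * lin w p"
  by (simp add: lin_def sum_distrib_left mult_ac)

lemma lin_V_inv_mult:
  "lin w (V_inv i * p) =
     (if i = 0 then 0 else lin (\<lambda>(l, m). w (l, m + Poly_Mapping.single i (- 1))) p)"
  by (auto simp: V_inv_def lin_mult_single case_prod_unfold add.commute
        intro!: lin_cong arg_cong[of _ _ w] prod_eqI)

text \<open>Every monomial of \<open>U r * p\<close> has a positive exponent of u_r, and (0)_n = 0
  for n >= 1.\<close>

lemma lin_wt_U_mult: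
  assumes "r \<ge> 1" "k r = 0"
  shows "lin (wt r k t) (U r * p) = 0"
proof -
  have "wt r k t ((Poly_Mapping.single r 1, 0) + x) = 0" for x
  proof -
    have "(\<Prod>j=1..r. pochhammer (real_of_int (k j)) (Poly_Mapping.lookup (Poly_Mapping.single r 1 + fst x) j)) = 0"
      by (rule prod_zero) (use assms in \<open>auto simp: lookup_add pochhammer_rec intro!: bexI[of _ r]\<close>)
    thus ?thesis by (cases x) (simp add: wt_def)
  qed
  hence "lin (\<lambda>x. wt r k t ((Poly_Mapping.single r 1, 0) + x)) p = 0" by (simp add: lin_def)
  thus ?thesis by (simp add: U_def lin_mult_single)
qed

lemma lin_wt_U_dvd:
  assumes "r \<ge> 1" "k r = 0" "U r dvd p - q"
  shows "lin (wt r k t) p = lin (wt r k t) q"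
proof -
  from assms(3) obtain s where "p - q = U r * s" by auto
  hence "lin (wt r k t) (p - q) = 0" using assms by (simp add: lin_wt_U_mult)
  thus ?thesis by (simp add: lin_diff)
qed

text \<open>Only the polylogarithms depend on t; multiplying a monomial by \<open>V_inv r\<close>
  lowers their last index, just as t d/dt does.\<close>

lemma DERIV_lin_wt:
  assumes "r \<ge> 1" "0 < t" "t < 1"
  shows "((\<lambda>t. lin (wt r k t) p) has_real_derivative lin (wt r k t) (V_inv r * p) / t) (at t)"
proof -
  define c where "c = (\<lambda>l. \<Prod>j=1..r. pochhammer (real_of_int (k j)) (Poly_Mapping.lookup (l :: nat \<Rightarrow>\<^sub>0 nat) j))"
  have wt: "wt r k t x = c (fst x) * mpl r (\<lambda>j. k j + Poly_Mapping.lookup (snd x) j) t" for x t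
    by (simp add: wt_def c_def case_prod_unfold)
  have "(wt r k t (l, m + Poly_Mapping.single r (- 1))) =
        c l * mpl r ((\<lambda>j. k j + Poly_Mapping.lookup m j)(r := k r + Poly_Mapping.lookup m r - 1)) t" for l m
    unfolding wt fst_conv snd_conv
    by (intro arg_cong[of _ _ "\<lambda>x. _ * x"] fun_cong[OF mpl_cong]) (auto simp: lookup_add lookup_single)
  hence *: "lin (wt r k t) (V_inv r * p) = lin (\<lambda>x. c (fst x) *
          mpl r ((\<lambda>j. k j + Poly_Mapping.lookup (snd x) j)(r := k r + Poly_Mapping.lookup (snd x) r - 1)) t) p"
    using assms by (simp add: lin_V_inv_mult case_prod_unfold)
  show ?thesis
    unfolding * unfolding lin_def wt sum_divide_distrib times_divide_eq_right[symmetric]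
    by (intro DERIV_sum DERIV_cmult DERIV_mpl assms)
qed

text \<open>Rests on (s-1)_n = (s)_n - n (s)_(n-1), whose last term is the transpose of
  \<open>deriv_u r\<close>. At n = 0 the truncated exponents are harmless, the factor n being
  0.\<close>

lemma lin_wt_shift:
  assumes "r \<ge> 1"
  shows "lin (wt r (k(r := k r - 1)) t) p = lin (wt r k t) (V_inv r * (p - deriv_u r p))"
proof -
  let ?e = "Poly_Mapping.single r (1::nat)" and ?f = "Poly_Mapping.single r (-1::int)"
  have "wt r (k(r := k r - 1)) t (l, m) = wt r k t (l, m + ?f) -
          real (Poly_Mapping.lookup l r) * wt r k t (l - ?e, m + ?f)" for l m
  proof -
    define P where "P = (\<Prod>j\<in>{1..<r}. pochhammer (real_of_int (k j)) (Poly_Mapping.lookup l j))"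
    let ?M = "mpl r (\<lambda>j. k j + Poly_Mapping.lookup (m + ?f) j) t"
    let ?x = "real_of_int (k r)" and ?n = "Poly_Mapping.lookup l r"
    have iv: "{1..r} = insert r {1..<r}" using assms by auto
    have split: "(\<Prod>j=1..r. g j) = g r * (\<Prod>j\<in>{1..<r}. g j)" for g :: "nat \<Rightarrow> real"
      unfolding iv by simp
    have 1: "wt r (k(r := k r - 1)) t (l, m) = pochhammer (?x - 1) ?n * P * ?M"
      unfolding wt_def split prod.case P_def
      by (intro arg_cong2[of _ _ _ _ "(*)"] fun_cong[OF mpl_cong] prod.cong)
         (auto simp: lookup_add lookup_single)
    have 2: "wt r k t (l, m + ?f) = pochhammer ?x ?n * P * ?M"
      unfolding wt_def split prod.case P_def ..
    have 3: "wt r k t (l - ?e, m + ?f) = pochhammer ?x (?n - 1) * P * ?M"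
      unfolding wt_def split prod.case P_def
      by (intro arg_cong2[of _ _ _ _ "(*)"] refl prod.cong) (auto simp: lookup_minus lookup_single)
    have "pochhammer (?x - 1) ?n = pochhammer ?x ?n - real ?n * pochhammer ?x (?n - 1)"
    proof (cases ?n)
      case (Suc n)
      have "pochhammer (?x - 1) (Suc n) = (?x - 1) * pochhammer ?x n"
        by (simp add: pochhammer_rec)
      thus ?thesis using Suc by (simp add: pochhammer_Suc algebra_simps)
    qed simp
    thus ?thesis unfolding 1 2 3 by (simp add: left_diff_distrib)
  qed
  hence "wt r (k(r := k r - 1)) t = (\<lambda>x. (\<lambda>(l, m). wt r k t (l, m + ?f)) x -
          (\<lambda>(l, m). real (Poly_Mapping.lookup l r) * wt r k t (l - ?e, m + ?f)) x)"
    by (auto simp: fun_eq_iff)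
  hence "lin (wt r (k(r := k r - 1)) t) p = lin (\<lambda>(l, m). wt r k t (l, m + ?f)) p -
          lin (\<lambda>(l, m). real (Poly_Mapping.lookup l r) * wt r k t (l - ?e, m + ?f)) p"
    by (simp only: lin_minus_weights)
  also have "\<dots> = lin (wt r k t) (V_inv r * (p - deriv_u r p))"
    using assms by (simp add: right_diff_distrib lin_diff lin_V_inv_mult lin_deriv_u)
  finally show ?thesis .
qed

text \<open>The hypothesis on the keys keeps u_(r+1) and v_(r+1) out of \<open>p\<close>, so the
  last index stays 0 and \<open>mpl_Suc_0\<close> and \<open>mpl_Suc_neg_1\<close> apply monomial by
  monomial.\<close>

lemma lin_wt_Suc:
  assumes "\<bar>t\<bar> < 1" "k (Suc r) = 0" and p: "Poly_Mapping.keys p \<subseteq> exponents r d e"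
  shows "lin (wt (Suc r) k t) p = t / (1 - t) * lin (wt r k t) p"
    and "lin (wt (Suc r) k t) ((V_inv (Suc r) - V_inv r) * p) = t / (1 - t)\<^sup>2 * lin (wt r k t) p"
proof -
  define c where "c = (\<lambda>r l. \<Prod>j=1..r. pochhammer (real_of_int (k j)) (Poly_Mapping.lookup (l :: nat \<Rightarrow>\<^sub>0 nat) j))"
  define M where "M = (\<lambda>m j. k j + Poly_Mapping.lookup (m :: nat \<Rightarrow>\<^sub>0 int) j)"
  have wt: "wt r k t (l, m) = c r l * mpl r (M m) t" for r l m
    by (simp add: wt_def c_def M_def)
  have supp: "Poly_Mapping.lookup l (Suc r) = 0" "Poly_Mapping.lookup m (Suc r) = 0"
    if "(l, m) \<in> Poly_Mapping.keys p" for l m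
  proof -
    have "Poly_Mapping.keys l \<subseteq> {1..r}" "Poly_Mapping.keys m \<subseteq> {1..r}"
      using that p by (auto simp: exponents_def)
    thus "Poly_Mapping.lookup l (Suc r) = 0" "Poly_Mapping.lookup m (Suc r) = 0"
      by (metis atLeastAtMost_iff in_keys_iff not_less_eq_eq order_refl subsetD)+
  qed
  have c: "c (Suc r) l = c r l" if "(l, m) \<in> Poly_Mapping.keys p" for l m
    using supp[OF that] by (simp add: c_def)
  have M: "M m (Suc r) = 0" if "(l, m) \<in> Poly_Mapping.keys p" for l m
    using supp[OF that] assms by (simp add: M_def)
  have "lin (wt (Suc r) k t) p = lin (\<lambda>x. t / (1 - t) * wt r k t x) p"
  proof (rule lin_cong, clarify)
    fix l m assume lm: "(l, m) \<in> Poly_Mapping.keys p"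
    show "wt (Suc r) k t (l, m) = t / (1 - t) * wt r k t (l, m)"
      using mpl_Suc_0[of t "M m" r, OF assms(1) M[OF lm]] by (simp add: wt c[OF lm])
  qed
  thus "lin (wt (Suc r) k t) p = t / (1 - t) * lin (wt r k t) p"
    by (simp only: lin_mult_weights)
  have shift: "M (m + Poly_Mapping.single i (- 1)) = (M m)(i := M m i - 1)" for i m
    by (auto simp: M_def lookup_add lookup_single fun_eq_iff)
  have "lin (wt (Suc r) k t) ((V_inv (Suc r) - V_inv r) * p) =
        lin (\<lambda>(l, m). wt (Suc r) k t (l, m + Poly_Mapping.single (Suc r) (- 1))) p -
        lin (\<lambda>(l, m). if r = 0 then 0 else wt (Suc r) k t (l, m + Poly_Mapping.single r (- 1))) p"
    by (simp add: left_diff_distrib lin_diff lin_V_inv_mult lin_def[of "\<lambda>_. 0"] case_prod_unfold)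
  also have "\<dots> = lin (\<lambda>x. t / (1 - t)\<^sup>2 * wt r k t x) p"
    unfolding lin_minus_weights[symmetric]
  proof (rule lin_cong, clarify)
    fix l m assume lm: "(l, m) \<in> Poly_Mapping.keys p"
    have "mpl (Suc r) ((M m)(Suc r := M m (Suc r) - 1)) t -
          (if r = 0 then 0 else mpl (Suc r) ((M m)(r := M m r - 1)) t) = t / (1 - t)\<^sup>2 * mpl r (M m) t"
      using mpl_Suc_neg_1[of t "M m" r, OF assms(1) M[OF lm]] M[OF lm] by simp
    hence "c r l * mpl (Suc r) ((M m)(Suc r := M m (Suc r) - 1)) t -
          c r l * (if r = 0 then 0 else mpl (Suc r) ((M m)(r := M m r - 1)) t) =
          t / (1 - t)\<^sup>2 * (c r l * mpl r (M m) t)"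
      unfolding right_diff_distrib[symmetric] by simp
    thus "wt (Suc r) k t (l, m + Poly_Mapping.single (Suc r) (- 1)) -
        (if r = 0 then 0 else wt (Suc r) k t (l, m + Poly_Mapping.single r (- 1))) =
        t / (1 - t)\<^sup>2 * wt r k t (l, m)"
      unfolding wt shift c[OF lm] by (simp split: if_splits)
  qed
  finally show "lin (wt (Suc r) k t) ((V_inv (Suc r) - V_inv r) * p) = t / (1 - t)\<^sup>2 * lin (wt r k t) p"
    by (simp only: lin_mult_weights)
qed

section \<open>The explicit formula\<close>

definition log_term :: "real \<Rightarrow> nat \<Rightarrow> real" where
  "log_term t q = (- 1) ^ q * (ln t ^ q / fact q)"

text \<open>The right-hand side of the formula, cut off at \<open>q = r\<close> because higher
  powers of \<open>vdu r\<close> kill \<open>\<G> r\<close>.\<close>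

definition des :: "nat \<Rightarrow> (nat \<Rightarrow> int) \<Rightarrow> real \<Rightarrow> real" where
  "des r k t = (\<Sum>q\<le>r. log_term t q * lin (wt r k t) ((vdu r ^^ q) (\<G> r)))"

lemma log_term_0 [simp]: "log_term t 0 = 1"
  by (simp add: log_term_def)

lemma log_term_Suc: "log_term t (Suc q) * real (Suc q) = - ln t * log_term t q"
  by (simp add: log_term_def field_simps del: of_nat_Suc)

lemma DERIV_log_term:
  assumes "0 < t"
  shows "((\<lambda>t. log_term t q) has_real_derivative
           (if q = 0 then 0 else - log_term t (q - 1) / t)) (at t)"
proof (cases q)
  case (Suc p)
  have "((\<lambda>t. (- 1) ^ Suc p * (ln t ^ Suc p / fact (Suc p))) has_real_derivative
           (- 1) ^ Suc p * (real (Suc p) * ln t ^ p * (1 / t) / fact (Suc p))) (at t)"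
    using assms by (auto intro!: derivative_eq_intros simp del: of_nat_Suc fact_Suc power_Suc)
  moreover have "real (Suc p) / fact (Suc p) = 1 / fact p" by (simp del: of_nat_Suc)
  hence "(- 1) ^ Suc p * (real (Suc p) * ln t ^ p * (1 / t) / fact (Suc p)) = - log_term t p / t"
    using assms by (simp add: log_term_def field_simps del: of_nat_Suc fact_Suc)
  ultimately show ?thesis
    by (simp only: log_term_def Suc nat.distinct if_False diff_Suc_1)
qed simp

lemma des_0: "des 0 k t = 1"
proof -
  have "lin (wt 0 k t) (Poly_Mapping.single (0, 0) 1) = 1"
    by (simp add: wt_def mpl_0_left)
  hence "lin (wt 0 k t) 1 = 1" by (simp only: single_one zero_prod_def[symmetric])
  thus ?thesis by (simp add: des_def \<G>_def)
qed

lemma des_cong: "(\<And>j. j \<in> {1..r} \<Longrightarrow> k j = k' j) \<Longrightarrow> des r k t = des r k' t"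
  using wt_cong[of r k k' t] by (simp add: des_def)

lemma des_at_0:
  assumes "r \<ge> 1"
  shows "des r k 0 = 0"
proof -
  have "wt r k 0 = (\<lambda>_. 0)" using assms by (auto simp: wt_def fun_eq_iff mpl_at_0)
  thus ?thesis by (simp add: des_def lin_def)
qed

text \<open>The product rule gives two sums. Differentiating the logarithms lowers \<open>q\<close>;
  after reindexing this contributes minus \<open>vdu r\<close>, and \<open>lin_wt_shift\<close>
  recognises the total.\<close>

lemma DERIV_des:
  assumes "r \<ge> 1" "0 < t" "t < 1"
  shows "(des r k has_real_derivative des r (k(r := k r - 1)) t / t) (at t)"
proof -
  define P where "P = (\<lambda>q. (vdu r ^^ q) (\<G> r))"
  define \<phi> where "\<phi> = lin (wt r k t)"
  define b' where "b' = (\<lambda>q. if q = 0 then 0 else - log_term t (q - 1) / t)"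
  have "(des r k has_real_derivative
          (\<Sum>q\<le>r. log_term t q * (\<phi> (V_inv r * P q) / t) + b' q * \<phi> (P q))) (at t)"
    unfolding des_def[abs_def] P_def \<phi>_def b'_def
    by (intro DERIV_sum DERIV_mult' DERIV_log_term DERIV_lin_wt assms)
  also have "(\<Sum>q\<le>r. log_term t q * (\<phi> (V_inv r * P q) / t) + b' q * \<phi> (P q)) =
             des r (k(r := k r - 1)) t / t"
  proof -
    \<comment> \<open>Adding the vanishing term \<open>q = Suc r\<close> makes the shifted sum run
      over all \<open>q \<le> r\<close>; the term at 0 drops out.\<close>
    have "P (Suc r) = 0" by (simp add: P_def funpow_vdu_\<G>_eq_0 del: funpow.simps)
    hence "(\<Sum>q\<le>r. b' q * \<phi> (P q)) = (\<Sum>q\<le>Suc r. b' q * \<phi> (P q))" by (simp add: \<phi>_def)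
    also have "\<dots> = (\<Sum>q\<le>r. - log_term t q / t * \<phi> (P (Suc q)))"
      unfolding sum.atMost_Suc_shift by (simp add: b'_def)
    finally have 1: "(\<Sum>q\<le>r. b' q * \<phi> (P q)) = (\<Sum>q\<le>r. - log_term t q / t * \<phi> (P (Suc q)))" .
    have "P (Suc q) = V_inv r * deriv_u r (P q)" for q by (simp add: P_def vdu_def)
    hence "lin (wt r (k(r := k r - 1)) t) (P q) = \<phi> (V_inv r * P q) - \<phi> (P (Suc q))" for q
      using assms by (simp add: lin_wt_shift \<phi>_def right_diff_distrib lin_diff)
    thus ?thesis
      unfolding des_def P_def[THEN fun_cong, symmetric] sum.distrib 1
      by (simp add: sum_divide_distrib right_diff_distrib diff_divide_distrib sum_subtractf sum_negf mult.commute)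
  qed
  finally show ?thesis .
qed

lemma des_Suc:
  assumes "0 < t" "t < 1" "k (Suc r) = 0"
  shows "des (Suc r) k t = Li_des0 t * des r k t"
proof -
  define P where "P = (\<lambda>q. (vdu r ^^ q) (\<G> r))"
  define Q where "Q = (\<lambda>q. (vdu (Suc r) ^^ q) (\<H> r))"
  define \<phi> where "\<phi> = lin (wt (Suc r) k t)"
  define w where "w = V_inv (Suc r) - V_inv r"
  define y where "y = 1 - U (Suc r) * V (Suc r) * w"
  have \<phi>_dvd: "\<phi> p = \<phi> q" if "U (Suc r) dvd p - q" for p q
    unfolding \<phi>_def using that assms by (intro lin_wt_U_dvd) auto
  have PQ: "U (Suc r) dvd Q q - P q" for q
    unfolding P_def Q_def by (rule U_dvd_funpow_vdu_diff)
  \<comment> \<open>Modulo \<open>U (Suc r)\<close>, \<open>y\<close> is 1 and \<open>Q q\<close> is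
    \<open>P q\<close>.\<close>
  have Qy: "\<phi> (Q q * y) = \<phi> (P q)" for q
  proof (rule \<phi>_dvd)
    have "Q q * y - P q = (Q q - P q) - U (Suc r) * (V (Suc r) * w * Q q)"
      by (simp add: y_def algebra_simps)
    thus "U (Suc r) dvd Q q * y - P q" using PQ by (metis dvd_diff dvd_triv_left)
  qed
  have wQ: "\<phi> (w * Q q) = \<phi> (w * P q)" for q
    by (rule \<phi>_dvd) (use PQ in \<open>simp flip: right_diff_distrib\<close>)
  have y: "vdu (Suc r) y = - w" and w: "vdu (Suc r) w = 0"
    by (simp_all add: y_def w_def vdu_diff vdu_mult[of _ "U _ * V _"] vdu_U_V)
  have G: "\<G> (Suc r) = \<H> r * y" by (simp add: \<G>_Suc y_def w_def)
  have step: "\<phi> ((vdu (Suc r) ^^ Suc q) (\<G> (Suc r))) = \<phi> (P (Suc q)) - real (Suc q) * \<phi> (w * P q)" for q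
  proof -
    have "(vdu (Suc r) ^^ Suc q) (\<G> (Suc r)) = Q (Suc q) * y - of_nat (Suc q) * (w * Q q)"
      unfolding G Q_def by (rule funpow_vdu_mult_linear[OF y w])
    hence "\<phi> ((vdu (Suc r) ^^ Suc q) (\<G> (Suc r))) = \<phi> (Q (Suc q) * y) - real (Suc q) * \<phi> (w * Q q)"
      by (simp only: \<phi>_def lin_diff lin_of_nat_mult)
    thus ?thesis by (simp only: Qy wQ)
  qed
  have "P (Suc r) = 0" by (simp add: P_def funpow_vdu_\<G>_eq_0 del: funpow.simps)
  have start: "\<phi> ((vdu (Suc r) ^^ 0) (\<G> (Suc r))) = \<phi> (P 0)"
    using Qy[of 0] by (simp add: G Q_def)
  have "des (Suc r) k t = \<phi> (P 0) +
      (\<Sum>q\<le>r. log_term t (Suc q) * (\<phi> (P (Suc q)) - real (Suc q) * \<phi> (w * P q)))"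
    unfolding des_def \<phi>_def[symmetric] sum.atMost_Suc_shift step start by simp
  also have "\<dots> = (\<phi> (P 0) + (\<Sum>q\<le>r. log_term t (Suc q) * \<phi> (P (Suc q)))) +
      (\<Sum>q\<le>r. - (log_term t (Suc q) * real (Suc q)) * \<phi> (w * P q))"
    by (simp add: right_diff_distrib sum_subtractf sum_negf mult.assoc del: of_nat_Suc)
  also have "\<phi> (P 0) + (\<Sum>q\<le>r. log_term t (Suc q) * \<phi> (P (Suc q))) = (\<Sum>q\<le>Suc r. log_term t q * \<phi> (P q))"
    unfolding sum.atMost_Suc_shift by simp
  also have "\<dots> = (\<Sum>q\<le>r. log_term t q * \<phi> (P q))"
    using \<open>P (Suc r) = 0\<close> by (simp add: \<phi>_def)
  \<comment> \<open>The factor \<open>Suc q\<close> from the Leibniz rule turns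
    \<open>log_term t (Suc q)\<close> into \<open>- ln t * log_term t q\<close>, which aligns the
    two sums.\<close>
  also have "\<dots> + (\<Sum>q\<le>r. - (log_term t (Suc q) * real (Suc q)) * \<phi> (w * P q)) =
      (\<Sum>q\<le>r. log_term t q * (\<phi> (P q) + ln t * \<phi> (w * P q)))"
    unfolding log_term_Suc by (simp add: distrib_left sum.distrib mult_ac)
  also have "\<dots> = (\<Sum>q\<le>r. log_term t q * (Li_des0 t * lin (wt r k t) (P q)))"
  proof (intro sum.cong refl arg_cong[of _ _ "\<lambda>x. _ * x"])
    fix q
    have keys: "Poly_Mapping.keys (P q) \<subseteq> exponents r (- int q) (int r - int q)"
      unfolding P_def by (rule keys_funpow_vdu_\<G>)
    have "\<bar>t\<bar> < 1" using assms by simp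
    have "\<phi> (P q) + ln t * \<phi> (w * P q) =
          t / (1 - t) * lin (wt r k t) (P q) + ln t * (t / (1 - t)\<^sup>2 * lin (wt r k t) (P q))"
      unfolding \<phi>_def w_def lin_wt_Suc[where k = k, OF \<open>\<bar>t\<bar> < 1\<close> assms(3) keys] ..
    thus "\<phi> (P q) + ln t * \<phi> (w * P q) = Li_des0 t * lin (wt r k t) (P q)"
      by (simp add: Li_des0_def algebra_simps)
  qed
  also have "\<dots> = Li_des0 t * des r k t"
    by (simp add: des_def P_def sum_distrib_left mult_ac)
  finally show ?thesis .
qed

section \<open>From derivatives to the operators J and D\<close>

lemma tendsto_des_at_0:
  assumes "r \<ge> 1"
  shows "(des r k \<longlongrightarrow> 0) (at_right 0)"
proof -
  have "((\<lambda>t. (\<Sum>q\<le>r. \<Sum>x\<in>Poly_Mapping.keys ((vdu r ^^ q) (\<G> r)).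
      ((- 1) ^ q / fact q * (real_of_int (Poly_Mapping.lookup ((vdu r ^^ q) (\<G> r)) x) *
       (\<Prod>j=1..r. pochhammer (real_of_int (k j)) (Poly_Mapping.lookup (fst x) j)))) *
      (ln t ^ q * mpl r (\<lambda>j. k j + Poly_Mapping.lookup (snd x) j) t))) \<longlongrightarrow> 0) (at_right 0)"
    by (intro tendsto_null_sum tendsto_mult_right_zero tendsto_ln_power_mult_mpl assms)
  thus ?thesis
    by (simp add: des_def[abs_def] lin_def wt_def case_prod_unfold log_term_def sum_distrib_left mult_ac)
qed

lemma continuous_on_des:
  assumes "r \<ge> 1" "0 < t" "t < 1"
  shows "continuous_on {0..t} (des r k)"
  unfolding continuous_on_eq_continuous_within
proof
  fix x assume x: "x \<in> {0..t}"
  show "continuous (at x within {0..t}) (des r k)"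
  proof (cases "x = 0")
    case True
    thus ?thesis
      using tendsto_des_at_0[OF assms(1)] assms
      by (simp add: continuous_within des_at_0 at_within_Icc_at_right)
  next
    case False
    hence "isCont (des r k) x"
      using x assms by (intro DERIV_isCont[OF DERIV_des]) auto
    thus ?thesis by (rule continuous_at_imp_continuous_at_within)
  qed
qed

text \<open>By \<open>DERIV_des\<close> at the raised index, the integrand is the derivative of a
  function that is continuous on \<open>{0..t}\<close> and vanishes at 0.\<close>

lemma op_J_des:
  assumes "r \<ge> 1" "0 < t" "t < 1" and f: "\<And>t. 0 < t \<Longrightarrow> t < 1 \<Longrightarrow> f t = des r k t"
  shows "op_J f t = des r (k(r := k r + 1)) t"
proof -
  let ?k = "k(r := k r + 1)"
  have "((\<lambda>z. des r k z / z) has_integral (des r ?k t - des r ?k 0)) {0..t}"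
  proof (rule fundamental_theorem_of_calculus_interior)
    show "continuous_on {0..t} (des r ?k)" by (rule continuous_on_des) fact+
    fix x assume "x \<in> {0<..<t}"
    thus "(des r ?k has_vector_derivative des r k x / x) (at x)"
      using DERIV_des[of r x ?k] assms by (simp add: has_real_derivative_iff_has_vector_derivative)
  qed (use assms in simp)
  hence "((\<lambda>z. f z / z) has_integral (des r ?k t - des r ?k 0)) {0..t}"
  proof (rule has_integral_eq[rotated])
    fix z assume "z \<in> {0..t}"
    \<comment> \<open>At \<open>z = 0\<close> both quotients are 0 by the convention on division;
      any other \<open>z\<close> lies in (0,1).\<close>
    thus "des r k z / z = f z / z" using assms by (cases "z = 0") auto
  qed
  thus ?thesis using assms by (simp add: op_J_def des_at_0 integral_unique)
qed

lemma op_D_des: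
  assumes "r \<ge> 1" "0 < t" "t < 1" and f: "\<And>t. 0 < t \<Longrightarrow> t < 1 \<Longrightarrow> f t = des r k t"
  shows "op_D f t = des r (k(r := k r - 1)) t"
proof -
  have "(f has_real_derivative des r (k(r := k r - 1)) t / t) (at t)"
    by (rule has_field_derivative_transform_within_open[OF DERIV_des[OF assms(1-3)], of "{0<..<1}"])
       (use assms in auto)
  thus ?thesis using assms by (simp add: op_D_def DERIV_imp_deriv)
qed

text \<open>The iterates are known only on (0,1), so the hypothesis on \<open>f\<close> is
  restricted to that interval, and every step reproduces it.\<close>

lemma J_pow_des:
  assumes "r \<ge> 1" "0 < t" "t < 1" and f: "\<And>t. 0 < t \<Longrightarrow> t < 1 \<Longrightarrow> f t = des r k t"
  shows "J_pow n f t = des r (k(r := k r + n)) t"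
proof -
  have J: "(op_J ^^ n) f t = des r (k(r := k r + int n)) t" if "0 < t" "t < 1" for n t
    using that
  proof (induction n arbitrary: t)
    case (Suc n)
    have "op_J ((op_J ^^ n) f) t =
        des r ((k(r := k r + int n))(r := (k(r := k r + int n)) r + 1)) t"
      by (rule op_J_des) (use Suc assms(1) in \<open>auto simp del: fun_upd_apply\<close>)
    also have "(k(r := k r + int n))(r := (k(r := k r + int n)) r + 1) = k(r := k r + int (Suc n))"
      by auto
    finally show ?case by (simp only: funpow.simps o_apply)
  qed (use f in simp)
  have D: "(op_D ^^ n) f t = des r (k(r := k r - int n)) t" if "0 < t" "t < 1" for n t
    using that
  proof (induction n arbitrary: t)
    case (Suc n)
    have "op_D ((op_D ^^ n) f) t =
        des r ((k(r := k r - int n))(r := (k(r := k r - int n)) r - 1)) t"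
      by (rule op_D_des) (use Suc assms(1) in \<open>auto simp del: fun_upd_apply\<close>)
    also have "(k(r := k r - int n))(r := (k(r := k r - int n)) r - 1) = k(r := k r - int (Suc n))"
      by auto
    finally show ?case by (simp only: funpow.simps o_apply)
  qed (use f in simp)
  show ?thesis using assms by (simp add: J_pow_def J D)
qed

text \<open>With the last index set to 0, \<open>des_Suc\<close> matches the function inside
  \<open>J_pow\<close>, which then moves that index from 0 to \<open>k (Suc r)\<close>.\<close>

lemma Li_des_eq_des:
  assumes "0 < t" "t < 1"
  shows "Li_des r k t = des r k t"
  using assms
proof (induction r arbitrary: t)
  case 0
  show ?case by (simp add: des_0)
next
  case (Suc r)
  let ?k = "k(Suc r := 0)"
  have "Li_des0 t * Li_des r k t = des (Suc r) ?k t" if "0 < t" "t < 1" for t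
    using that des_cong[of r k ?k t] by (simp add: des_Suc Suc.IH)
  hence "J_pow (k (Suc r)) (\<lambda>t. Li_des0 t * Li_des r k t) t = des (Suc r) (?k(Suc r := ?k (Suc r) + k (Suc r))) t"
    using Suc.prems by (intro J_pow_des) auto
  thus ?case by simp
qed

text \<open>The coefficients vanish off a finite set of keys, which lies in
  \<open>index_set r q\<close> by the degree count, so the infinite sum collapses to
  \<open>lin\<close>.\<close>

lemma infsum_index_set:
  assumes "r \<ge> 1" "0 < t" "t < 1"
  shows "(\<Sum>\<^sub>\<infinity>(l, m)\<in>index_set r q.
               real_of_int (coeff_a r q l m) *
               (\<Prod>j=1..r. pochhammer (real_of_int (k j)) (Poly_Mapping.lookup l j)) *
               multi_polylog r (\<lambda>j. k j + Poly_Mapping.lookup m j) t) =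
         lin (wt r k t) ((vdu r ^^ q) (\<G> r))"
proof -
  let ?p = "(vdu r ^^ q) (\<G> r)"
  let ?h = "\<lambda>x. real_of_int (Poly_Mapping.lookup ?p x) * wt r k t x"
  have "(\<lambda>p. V_inv r * deriv_u r p) = vdu r" by (simp add: vdu_def fun_eq_iff)
  hence "(\<lambda>(l, m). real_of_int (coeff_a r q l m) *
               (\<Prod>j=1..r. pochhammer (real_of_int (k j)) (Poly_Mapping.lookup l j)) *
               multi_polylog r (\<lambda>j. k j + Poly_Mapping.lookup m j) t) = ?h"
    using assms by (auto simp: fun_eq_iff coeff_a_def wt_def multi_polylog_eq_mpl)
  moreover have "infsum ?h (index_set r q) = infsum ?h (Poly_Mapping.keys ?p)"
  proof (rule infsum_cong_neutral)
    fix x assume "x \<in> Poly_Mapping.keys ?p - index_set r q"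
    moreover have "Poly_Mapping.keys ?p \<subseteq> index_set r q"
      using keys_funpow_vdu_\<G>[where q = q and r = r] by (auto simp: exponents_def index_set_def)
    ultimately show "?h x = 0" by blast
  qed (auto simp: in_keys_iff)
  ultimately show ?thesis by (simp add: lin_def)
qed

theorem theorem3p16:
  fixes r :: nat and k :: "nat \<Rightarrow> int" and t :: real
  assumes "r \<ge> 1" and "t \<in> {0<..<1}"
  shows "(\<lambda>q. (- 1) ^ q * ((ln t) ^ q / fact q) *
            (\<Sum>\<^sub>\<infinity>(l, m)\<in>index_set r q.
               real_of_int (coeff_a r q l m) *
               (\<Prod>j=1..r. pochhammer (real_of_int (k j)) (Poly_Mapping.lookup l j)) *
               multi_polylog r (\<lambda>j. k j + Poly_Mapping.lookup m j) t))
         sums Li_des r k t"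
proof -
  have t: "0 < t" "t < 1" using assms(2) by auto
  have "(\<lambda>q. log_term t q * lin (wt r k t) ((vdu r ^^ q) (\<G> r))) sums des r k t"
    unfolding des_def by (rule sums_finite) (simp_all add: funpow_vdu_\<G>_eq_0)
  thus ?thesis
    unfolding infsum_index_set[OF assms(1) t] Li_des_eq_des[OF t] log_term_def .
qed

end
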